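(* (Associated Al-Salam–Carlitz I case.) Let $0<|q|<1$ and let $A,\delta$ be nonzero complex numbers with $A\notin\{q^{-k}:k\ge0\}$. Then for $z\neq0$ for which the right-hand side is defined, $$\cfrac{1}{z-(1+\delta^{-1})+\cfrac{q(1-A)/(A\delta)}{z-(1+\delta^{-1})q+\cfrac{q^2(1-Aq)/(A\delta)}{z-(1+\delta^{-1})q^2+\cdots}}}=\frac{1}{z\left(1-\frac{1}{\delta z}\right)}\;\frac{{}_1\phi_1\left(\begin{matrix}q/(Az\delta)\\ q/(z\delta)\end{matrix};\frac qz\right)}{{}_1\phi_1\left(\begin{matrix}q/(Az\delta)\\ 1/(z\delta)\end{matrix};\frac1z\right)},$$ where the $n$-th partial numerator ($n\ge1$) is $q^n(1-Aq^{n-1})/(A\delta)$ and the partial denominators are $z-(1+\delta^{-1})q^n$ ($n\ge0$).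
   Context: Notation: $(a)_k=\prod_{j=0}^{k-1}(1-aq^j)$ and ${}_1\phi_1\left(\begin{matrix}a\\ c\end{matrix};w\right)=\sum_{k\ge0}\frac{(a)_k}{(c)_k(q)_k}(-1)^kq^{k(k-1)/2}w^k$. "Defined" means that no lower parameter is of the form $q^{-k}$ ($k\ge0$) and the denominator does not vanish. *)

theory Defs
  imports "HOL-Analysis.Analysis"
begin

definition qpoch :: "complex \<Rightarrow> complex \<Rightarrow> nat \<Rightarrow> complex" where
  "qpoch q a k = (\<Prod>j<k. 1 - a * q ^ j)"

definition phi11 :: "complex \<Rightarrow> complex \<Rightarrow> complex \<Rightarrow> complex \<Rightarrow> complex" where
  "phi11 q a c w =
     (\<Sum>k. qpoch q a k / (qpoch q c k * qpoch q q k) * (-1) ^ k * q ^ (k * (k - 1) div 2) * w ^ k)"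

definition admissible_lower :: "complex \<Rightarrow> complex \<Rightarrow> bool" where
  "admissible_lower q c \<longleftrightarrow> (\<forall>k::nat. c \<noteq> inverse (q ^ k))"

text \<open>
  Continued fractions a 0 / (b 0 + a 1 / (b 1 + a 2 / (b 2 + ...))).
  The approximant with n levels is cf_num a b n / cf_den a b n, where numerators and
  denominators come from the Euler-Wallis recurrence. Unlike a literal evaluation of the nested
  fraction, this remains correct when an inner denominator is zero (in HOL, x / 0 = 0, whereas
  there the intermediate value has to be read as infinity); see cf_nested_eq.
\<close>

fun cf_num :: "(nat \<Rightarrow> complex) \<Rightarrow> (nat \<Rightarrow> complex) \<Rightarrow> nat \<Rightarrow> complex" where
  "cf_num a b 0 = 0"
| "cf_num a b (Suc 0) = a 0"
| "cf_num a b (Suc (Suc n)) = b (Suc n) * cf_num a b (Suc n) + a (Suc n) * cf_num a b n"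

fun cf_den :: "(nat \<Rightarrow> complex) \<Rightarrow> (nat \<Rightarrow> complex) \<Rightarrow> nat \<Rightarrow> complex" where
  "cf_den a b 0 = 1"
| "cf_den a b (Suc 0) = b 0"
| "cf_den a b (Suc (Suc n)) = b (Suc n) * cf_den a b (Suc n) + a (Suc n) * cf_den a b n"

text \<open>
  Convergence to a finite value: as usual, finitely many approximants may be infinite, so
  the denominators only have to be nonzero eventually.
\<close>

definition cf_converges_to ::
    "(nat \<Rightarrow> complex) \<Rightarrow> (nat \<Rightarrow> complex) \<Rightarrow> complex \<Rightarrow> bool" where
  "cf_converges_to a b v \<longleftrightarrow>
     (\<forall>\<^sub>F n in sequentially. cf_den a b n \<noteq> 0) \<and>
     (\<lambda>n. cf_num a b n / cf_den a b n) \<longlonglongrightarrow> v"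

fun cf_nested :: "(nat \<Rightarrow> complex) \<Rightarrow> (nat \<Rightarrow> complex) \<Rightarrow> nat \<Rightarrow> complex" where
  "cf_nested a b 0 = 0"
| "cf_nested a b (Suc n) = a 0 / (b 0 + cf_nested (\<lambda>i. a (Suc i)) (\<lambda>i. b (Suc i)) n)"

lemma cf_shift:
  "cf_num a b (Suc n) = a 0 * cf_den (\<lambda>i. a (Suc i)) (\<lambda>i. b (Suc i)) n"
  "cf_den a b (Suc n) = b 0 * cf_den (\<lambda>i. a (Suc i)) (\<lambda>i. b (Suc i)) n
     + cf_num (\<lambda>i. a (Suc i)) (\<lambda>i. b (Suc i)) n"
proof (induction n rule: induct_nat_012)
  case (ge2 n)
  { case 1 show ?case using ge2 by (simp add: algebra_simps)
  next
    case 2 show ?case using ge2 by (simp add: algebra_simps) }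
qed (simp_all add: algebra_simps)

lemma cf_nested_eq:
  assumes "\<And>m. m \<le> n \<Longrightarrow> cf_den (\<lambda>i. a (m + i)) (\<lambda>i. b (m + i)) (n - m) \<noteq> 0"
  shows "cf_nested a b n = cf_num a b n / cf_den a b n"
  using assms
proof (induction n arbitrary: a b)
  case (Suc n)
  let ?a = "\<lambda>i. a (Suc i)" and ?b = "\<lambda>i. b (Suc i)"
  have IH: "cf_nested ?a ?b n = cf_num ?a ?b n / cf_den ?a ?b n"
    by (rule Suc.IH) (use Suc.prems[of "Suc _"] in simp)
  have "cf_den ?a ?b n \<noteq> 0" using Suc.prems[of 1] by simp
  then show ?case by (simp add: IH cf_shift add_divide_eq_iff)
qed simp

end

(* With c = 1/(z delta), a = q/(A z delta), w = 1/z, the functions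
     T n = sum_k (a)_k / ((c)_(n+k) (q)_k) (-1)^k q^(k(k-1)/2) (w q^n)^k
   satisfy the contiguous relation
     T n = (1 - (w + c) q^n) T (n+1) + w q^n (a - q c q^n) T (n+2),
   so t n = T n / z^n solves t n = b n * t (n+1) + a (n+1) * t (n+2), the adjoint of the
   Euler-Wallis recurrence. For a solution y of the latter,
   y (n+1) * t (n+1) + a (n+1) * y n * t (n+2) does not depend on n. The coefficients approach
   their limits geometrically, hence y n / z^n and T n are bounded and the second summand
   tends to 0. Therefore den n * t n tends to t 0, num n * t n to t 1, and the value is t 1 / t 0. *)
theory Submission
  imports Defs
begin

section \<open>Geometrically perturbed recurrences and q-Pochhammer symbols\<close>

text \<open>One step enlarges the maximum of two consecutive terms by a factor of at most
  \<open>1 + 2 * C * r ^ n\<close>, and the product of these factors stays bounded because the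
  geometric series converges. The same principle serves q-Pochhammer symbols, their inverses and
  normalised Euler-Wallis solutions.\<close>

lemma bounded_of_geometric_perturbation:
  fixes y :: "nat \<Rightarrow> real"
  assumes r: "0 \<le> r" "r < 1" and C: "0 \<le> C" and y0: "\<And>n. 0 \<le> y n"
    and step: "\<And>n. y (Suc (Suc n)) \<le> (1 + C * r ^ n) * y (Suc n) + C * r ^ n * y n"
  shows "\<exists>K. \<forall>n. y n \<le> K"
proof -
  define P where "P n = (\<Prod>j<n. 1 + 2 * C * r ^ j)" for n
  define K where "K = max (y 0) (y 1)"
  have K0: "K \<ge> 0" using y0[of 0] unfolding K_def by linarith
  have P0: "P n \<ge> 0" for n
    unfolding P_def using r C by (intro prod_nonneg) auto
  have PS: "P (Suc n) = P n * (1 + 2 * C * r ^ n)" for n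
    by (simp add: P_def)
  have ind: "y n \<le> K * P n \<and> y (Suc n) \<le> K * P n" for n
  proof (induction n)
    case 0
    show ?case by (simp add: P_def K_def)
  next
    case (Suc n)
    have Cr: "0 \<le> C * r ^ n" using r C by simp
    have KP: "0 \<le> K * P n" using K0 P0 by simp
    have "y (Suc (Suc n)) \<le> (1 + C * r ^ n) * (K * P n) + C * r ^ n * (K * P n)"
      using step[of n] mult_left_mono[of "y (Suc n)" "K * P n" "1 + C * r ^ n"]
        mult_left_mono[of "y n" "K * P n" "C * r ^ n"] Suc Cr by linarith
    also have "\<dots> = K * P (Suc n)" by (simp add: PS algebra_simps)
    finally have 1: "y (Suc (Suc n)) \<le> K * P (Suc n)" .
    have "K * P n \<le> K * P (Suc n)"
      using mult_nonneg_nonneg[OF KP Cr] by (simp add: PS algebra_simps)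
    with 1 Suc show ?case by linarith
  qed
  \<comment> \<open>From \<open>1 + x \<le> exp x\<close>, the product is at most the exponential of
    a geometric sum.\<close>
  have "P n \<le> exp (2 * C / (1 - r))" for n
  proof -
    have "P n \<le> (\<Prod>j<n. exp (2 * C * r ^ j))"
      unfolding P_def using r C by (intro prod_mono) (auto intro: exp_ge_add_one_self)
    also have "\<dots> = exp (2 * C * (\<Sum>j<n. r ^ j))"
      by (simp add: exp_sum sum_distrib_left)
    also have "\<dots> \<le> exp (2 * C * (1 / (1 - r)))"
    proof -
      have "(\<Sum>j<n. r ^ j) \<le> (\<Sum>j. r ^ j)"
        using r by (intro sum_le_suminf summable_geometric) auto
      then have "(\<Sum>j<n. r ^ j) \<le> 1 / (1 - r)"
        using r by (simp add: suminf_geometric)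
      then have "2 * C * (\<Sum>j<n. r ^ j) \<le> 2 * C * (1 / (1 - r))"
        using C by (intro mult_left_mono) auto
      then show ?thesis by (simp only: exp_le_cancel_iff)
    qed
    finally show ?thesis by simp
  qed
  then have "y n \<le> K * exp (2 * C / (1 - r))" for n
    using ind[of n] mult_left_mono[OF _ K0, of "P n"] by (meson order_trans)
  then show ?thesis by blast
qed

lemma qpoch_Suc: "qpoch q a (Suc k) = qpoch q a k * (1 - a * q ^ k)"
  by (simp add: qpoch_def)

lemma qpoch_shift: "qpoch q a (Suc k) = (1 - a) * qpoch q (a * q) k"
  unfolding qpoch_def by (subst prod.lessThan_Suc_shift) (simp add: mult.assoc)

lemma qpoch_bounded:
  assumes "norm q < 1"
  shows "\<exists>K. \<forall>n. norm (qpoch q a n) \<le> K"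
proof (rule bounded_of_geometric_perturbation[where r = "norm q" and C = "norm a"])
  fix n
  have "norm (1 - a * q ^ Suc n) \<le> 1 + norm a * norm q ^ Suc n"
    by (rule order_trans[OF norm_triangle_ineq4]) (simp add: norm_mult norm_power)
  also have "\<dots> \<le> 1 + norm a * norm q ^ n"
    using assms by (auto intro!: mult_left_mono simp: mult_left_le_one_le)
  finally have "norm (qpoch q a (Suc (Suc n)))
      \<le> (1 + norm a * norm q ^ n) * norm (qpoch q a (Suc n))"
    by (subst qpoch_Suc) (simp add: norm_mult mult.commute mult_left_mono)
  \<comment> \<open>The recurrence is of first order; adding a nonnegative term brings it into the
    two-term shape of the general principle.\<close>
  then show "norm (qpoch q a (Suc (Suc n)))
      \<le> (1 + norm a * norm q ^ n) * norm (qpoch q a (Suc n))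
        + norm a * norm q ^ n * norm (qpoch q a n)"
    by (smt (verit) mult_nonneg_nonneg norm_ge_zero zero_le_power)
qed (use assms in auto)

text \<open>The identity \<open>1 / (1 - x) = 1 + x / (1 - x)\<close> makes each new factor a
  geometrically small perturbation of 1, provided the numbers \<open>inverse (1 - a * q ^ n)\<close>
  have a common bound \<open>B\<close>. They do, since they converge.\<close>

lemma inverse_qpoch_bounded:
  assumes q: "norm q < 1" and nz: "\<And>k. 1 - a * q ^ k \<noteq> 0"
  shows "\<exists>K. \<forall>n. norm (inverse (qpoch q a n)) \<le> K"
proof -
  have "(\<lambda>n. inverse (1 - a * q ^ n)) \<longlonglongrightarrow> inverse (1 - a * 0)"
    by (intro tendsto_intros LIMSEQ_power_zero q) simp
  then have "Bseq (\<lambda>n. inverse (1 - a * q ^ n))"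
    using convergent_imp_Bseq convergentI by blast
  then obtain B where B: "B > 0" "\<And>n. norm (inverse (1 - a * q ^ n)) \<le> B"
    by (auto simp: Bseq_def)
  show ?thesis
  proof (rule bounded_of_geometric_perturbation[where r = "norm q" and C = "norm a * B"])
    fix n
    have "inverse (1 - a * q ^ Suc n) = 1 + a * q ^ Suc n * inverse (1 - a * q ^ Suc n)"
      using nz[of "Suc n"] by (simp add: field_simps)
    then have "norm (inverse (1 - a * q ^ Suc n))
        \<le> 1 + norm (a * q ^ Suc n * inverse (1 - a * q ^ Suc n))"
      by (metis norm_one norm_triangle_ineq)
    also have "\<dots> = 1 + norm a * norm q ^ Suc n * norm (inverse (1 - a * q ^ Suc n))"
      by (simp only: norm_mult norm_power)
    also have "\<dots> \<le> 1 + norm a * norm q ^ n * B"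
      using B(1) B(2)[of "Suc n"] q
      by (intro add_left_mono mult_mono) (auto simp: mult_left_le_one_le)
    finally have "norm (inverse (1 - a * q ^ Suc n)) \<le> 1 + norm a * B * norm q ^ n"
      by (simp add: mult_ac)
    then have "norm (inverse (qpoch q a (Suc (Suc n))))
        \<le> (1 + norm a * B * norm q ^ n) * norm (inverse (qpoch q a (Suc n)))"
      by (subst qpoch_Suc) (simp only: norm_mult inverse_mult_distrib mult.commute
          mult_left_mono norm_ge_zero)
    then show "norm (inverse (qpoch q a (Suc (Suc n))))
        \<le> (1 + norm a * B * norm q ^ n) * norm (inverse (qpoch q a (Suc n)))
          + norm a * B * norm q ^ n * norm (inverse (qpoch q a n))"
      using B(1) by (smt (verit) mult_nonneg_nonneg norm_ge_zero zero_le_power)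
  qed (use q B in auto)
qed

section \<open>The shifted series: majorant and contiguous relation\<close>

lemma triangular_Suc: "Suc k * (Suc k - 1) div 2 = k * (k - 1) div 2 + k"
proof -
  have "Suc k * (Suc k - 1) = k * (k - 1) + 2 * k" by (cases k) auto
  then show ?thesis by simp
qed

text \<open>The ratio of consecutive terms is \<open>r ^ k * x\<close>, which tends to 0. This
  partial theta series is the common majorant of all shifted series.\<close>

lemma summable_theta:
  fixes r x :: real
  assumes "0 \<le> r" "r < 1" "0 \<le> x"
  shows "summable (\<lambda>k. r ^ (k * (k - 1) div 2) * x ^ k)"
proof -
  have "(\<lambda>k. r ^ k * x) \<longlonglongrightarrow> 0 * x"
    by (intro tendsto_intros LIMSEQ_power_zero) (use assms in auto)
  then have "\<forall>\<^sub>F k in sequentially. r ^ k * x < 1 / 2"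
    by (intro order_tendstoD) auto
  then obtain N where N: "\<And>k. k \<ge> N \<Longrightarrow> r ^ k * x < 1 / 2"
    by (auto simp: eventually_sequentially)
  show ?thesis
  proof (rule summable_ratio_test[where c = "1/2" and N = N])
    fix k assume "k \<ge> N"
    let ?u = "r ^ (k * (k - 1) div 2) * x ^ k"
    have "r ^ (Suc k * (Suc k - 1) div 2) * x ^ Suc k = (r ^ k * x) * ?u"
      by (simp only: triangular_Suc power_add) simp
    also have "\<dots> \<le> 1 / 2 * ?u"
      using N[OF \<open>k \<ge> N\<close>] assms by (intro mult_right_mono) auto
    finally show "norm (r ^ (Suc k * (Suc k - 1) div 2) * x ^ Suc k) \<le> 1 / 2 * norm ?u"
      using assms by simp
  qed simp
qed

text \<open>For admissible \<open>c\<close>, summing over \<open>k\<close> gives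
  \<open>phi11 q a (c * q ^ n) (w * q ^ n) / qpoch q c n\<close>. The division by
  \<open>qpoch q c n\<close>, hidden in the index \<open>n + k\<close>, makes the coefficients of
  the contiguous relation polynomials in \<open>q ^ n\<close>.\<close>

definition phi_term :: "complex \<Rightarrow> complex \<Rightarrow> complex \<Rightarrow> complex \<Rightarrow> nat \<Rightarrow> nat \<Rightarrow> complex" where
  "phi_term q a c w n k = qpoch q a k / (qpoch q c (n + k) * qpoch q q k)
     * (-1) ^ k * q ^ (k * (k - 1) div 2) * (w * q ^ n) ^ k"

text \<open>This is the contiguous relation compared at equal powers of \<open>w\<close>: a
  coefficient containing \<open>w\<close> pairs index \<open>k\<close> with \<open>Suc k\<close>, so
  index 0 receives no such contribution.\<close>

lemma phi_term_contiguous: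
  assumes c: "\<And>k. 1 - c * q ^ k \<noteq> 0" and q: "\<And>k. 1 - q * q ^ k \<noteq> 0"
  shows "phi_term q a c w n 0 = (1 - c * q ^ n) * phi_term q a c w (Suc n) 0"
    and "phi_term q a c w n (Suc k) = (1 - c * q ^ n) * phi_term q a c w (Suc n) (Suc k)
           - w * q ^ n * phi_term q a c w (Suc n) k
           + w * q ^ n * (a - q * c * q ^ n) * phi_term q a c w (Suc (Suc n)) k"
proof -
  have cn: "qpoch q c m \<noteq> 0" and qn: "qpoch q q m \<noteq> 0" for m
    using c q by (auto simp: qpoch_def)
  show "phi_term q a c w n 0 = (1 - c * q ^ n) * phi_term q a c w (Suc n) 0"
    using c[of n] by (simp add: phi_term_def qpoch_Suc)
  \<comment> \<open>\<open>G\<close> is the summand \<open>phi_term q a c w n k\<close>; the four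
    terms involved are \<open>G\<close> times rational functions of \<open>x\<close> and
    \<open>y\<close> whose denominators divide \<open>d * e * f\<close>.\<close>
  define G where "G = qpoch q a k / (qpoch q c (n + k) * qpoch q q k)
     * (-1) ^ k * q ^ (k * (k - 1) div 2) * (w * q ^ n) ^ k"
  define x where "x = q ^ n"
  define y where "y = q ^ k"
  define d where "d = 1 - c * x * y"
  define e where "e = 1 - c * q * x * y"
  define g where "g = 1 - a * y"
  define f where "f = 1 - q * y"
  have nz: "d \<noteq> 0" "e \<noteq> 0" "f \<noteq> 0"
    using c[of "n + k"] c[of "Suc (n + k)"] q[of k]
    by (auto simp: d_def e_def f_def x_def y_def power_add mult_ac)
  have ce: "qpoch q c (Suc (n + k)) = qpoch q c (n + k) * d"
      "qpoch q c (Suc (Suc (n + k))) = qpoch q c (n + k) * d * e"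
      "qpoch q q (Suc k) = qpoch q q k * f"
      "qpoch q a (Suc k) = qpoch q a k * g"
    by (simp_all add: qpoch_Suc d_def e_def f_def g_def x_def y_def power_add mult_ac)
  have t: "q ^ (Suc k * (Suc k - 1) div 2) = q ^ (k * (k - 1) div 2) * y"
    by (simp only: triangular_Suc power_add y_def)
  have pw: "(w * q ^ Suc n) ^ m = (w * q ^ n) ^ m * q ^ m"
      "(w * q ^ Suc (Suc n)) ^ m = (w * q ^ n) ^ m * q ^ m * q ^ m" for m
    by (simp_all add: power_mult_distrib[symmetric] mult_ac)
  have 1: "phi_term q a c w n (Suc k) = G * (- g * y * w * x / (d * f))"
    unfolding phi_term_def t add_Suc_right ce G_def
    by (simp add: x_def divide_simps mult_ac)
  have 2: "phi_term q a c w (Suc n) (Suc k)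
      = G * (- g * y * w * x * q * y / (d * e * f))"
    unfolding phi_term_def t pw add_Suc_right add_Suc ce G_def
    by (simp add: x_def y_def divide_simps mult_ac)
  have 3: "phi_term q a c w (Suc n) k = G * (y / d)"
    unfolding phi_term_def pw add_Suc ce G_def
    by (simp add: y_def divide_simps mult_ac)
  have 4: "phi_term q a c w (Suc (Suc n)) k = G * (y * y / (d * e))"
    unfolding phi_term_def pw add_Suc ce G_def
    by (simp add: y_def divide_simps mult_ac)
  have lin: "G * (p * u - m * v + l * s) = p * (G * u) - m * (G * v) + l * (G * s)"
    for p u m v l s :: complex
    by (simp add: algebra_simps)
  \<comment> \<open>The relation with \<open>G\<close> removed and the common denominator
    \<open>d * e * f\<close> cleared.\<close>
  have poly: "- g * y * w * x * e = (1 - c * x) * (- g * y * w * x * q * y)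
      - w * x * y * e * f + w * x * (a - q * c * x) * y * y * f"
    unfolding e_def f_def g_def by (simp add: algebra_simps)
  have "- g * y * w * x / (d * f)
      = (- g * y * w * x * e) / (d * e * f)"
    using nz by (simp add: divide_simps)
  also have "\<dots> = (1 - c * x) * (- g * y * w * x * q * y / (d * e * f))
      - w * x * (y / d) + w * x * (a - q * c * x) * (y * y / (d * e))"
    unfolding poly using nz by (simp add: add_divide_distrib diff_divide_distrib)
  finally show "phi_term q a c w n (Suc k) = (1 - c * q ^ n) * phi_term q a c w (Suc n) (Suc k)
           - w * q ^ n * phi_term q a c w (Suc n) k
           + w * q ^ n * (a - q * c * q ^ n) * phi_term q a c w (Suc (Suc n)) k"
    unfolding 1 2 3 4 x_def[symmetric] by (simp only: lin)
qed

text \<open>\<open>M\<close> must not depend on \<open>n\<close>, so that one constant bounds every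
  shifted series. The inverse symbols are bounded over all indices, and the powers of
  \<open>q ^ n\<close> have norm at most 1.\<close>

lemma phi_term_bound:
  assumes q: "norm q < 1" and c: "\<And>k. 1 - c * q ^ k \<noteq> 0" and qq: "\<And>k. 1 - q * q ^ k \<noteq> 0"
  shows "\<exists>M. \<forall>n k. norm (phi_term q a c w n k)
           \<le> M * (norm q ^ (k * (k - 1) div 2) * norm w ^ k)"
proof -
  obtain K1 where K1: "\<And>n. norm (qpoch q a n) \<le> K1"
    using qpoch_bounded[OF q] by blast
  obtain K2 where K2: "\<And>n. norm (inverse (qpoch q c n)) \<le> K2"
    using inverse_qpoch_bounded[OF q c] by blast
  obtain K3 where K3: "\<And>n. norm (inverse (qpoch q q n)) \<le> K3"
    using inverse_qpoch_bounded[OF q qq] by blast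
  have K: "0 \<le> K1" "0 \<le> K2" "0 \<le> K3"
    using K1[of 0] K2[of 0] K3[of 0] norm_ge_zero order_trans by blast+
  have "norm (phi_term q a c w n k)
           \<le> (K1 * (K2 * K3)) * (norm q ^ (k * (k - 1) div 2) * norm w ^ k)" for n k
  proof -
    have "norm (phi_term q a c w n k)
      = (norm (qpoch q a k) * (norm (inverse (qpoch q c (n + k))) * norm (inverse (qpoch q q k))))
        * (norm q ^ (k * (k - 1) div 2) * (norm w * norm q ^ n) ^ k)"
      by (simp add: phi_term_def norm_mult norm_divide norm_power norm_inverse divide_inverse)
    also have "\<dots> \<le> (K1 * (K2 * K3)) * (norm q ^ (k * (k - 1) div 2) * norm w ^ k)"
      using K q by (intro mult_mono K1 K2 K3 order_refl power_mono)
        (auto intro!: mult_right_le_one_le power_le_one)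
    finally show ?thesis .
  qed
  then show ?thesis by blast
qed

section \<open>Continued fractions and the adjoint recurrence\<close>

text \<open>Expanding \<open>t (Suc n)\<close> by the adjoint recurrence and collecting the
  coefficient of \<open>t (Suc (Suc n))\<close> produces the next Euler-Wallis term. The constants
  are the values at \<open>n = 0\<close>.\<close>

lemma cf_invariant:
  assumes t: "\<And>n. t n = b n * t (Suc n) + a (Suc n) * t (Suc (Suc n))"
  shows "cf_den a b (Suc n) * t (Suc n) + a (Suc n) * (cf_den a b n * t (Suc (Suc n))) = t 0"
    and "cf_num a b (Suc n) * t (Suc n) + a (Suc n) * (cf_num a b n * t (Suc (Suc n))) = a 0 * t 1"
proof (induction n)
  case 0
  { case 1 show ?case using t[of 0] by simp
  next
    case 2 show ?case by simp }
next
  case (Suc n)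
  { case 1 show ?case using Suc(1) t[of "Suc n"] by (simp add: algebra_simps)
  next
    case 2 show ?case using Suc(2) t[of "Suc n"] by (simp add: algebra_simps) }
qed

lemma cf_converges_to_adjoint:
  assumes t: "\<And>n. t n = b n * t (Suc n) + a (Suc n) * t (Suc (Suc n))" and "t 0 \<noteq> 0"
    and den: "(\<lambda>n. a (Suc n) * (cf_den a b n * t (Suc (Suc n)))) \<longlonglongrightarrow> 0"
    and num: "(\<lambda>n. a (Suc n) * (cf_num a b n * t (Suc (Suc n)))) \<longlonglongrightarrow> 0"
  shows "cf_converges_to a b (a 0 * t 1 / t 0)"
proof -
  have "(\<lambda>n. t 0 - a (Suc n) * (cf_den a b n * t (Suc (Suc n)))) \<longlonglongrightarrow> t 0 - 0"
    by (intro tendsto_intros den)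
  moreover have "t 0 - a (Suc n) * (cf_den a b n * t (Suc (Suc n)))
      = cf_den a b (Suc n) * t (Suc n)" for n
    using cf_invariant(1)[of t b a n, OF t] by (simp add: algebra_simps)
  ultimately have D: "(\<lambda>n. cf_den a b n * t n) \<longlonglongrightarrow> t 0"
    using LIMSEQ_imp_Suc[of "\<lambda>n. cf_den a b n * t n"] by simp
  have "(\<lambda>n. a 0 * t 1 - a (Suc n) * (cf_num a b n * t (Suc (Suc n)))) \<longlonglongrightarrow> a 0 * t 1 - 0"
    by (intro tendsto_intros num)
  moreover have "a 0 * t 1 - a (Suc n) * (cf_num a b n * t (Suc (Suc n)))
      = cf_num a b (Suc n) * t (Suc n)" for n
    using cf_invariant(2)[of t b a n, OF t] by (simp add: algebra_simps)
  ultimately have N: "(\<lambda>n. cf_num a b n * t n) \<longlonglongrightarrow> a 0 * t 1"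
    using LIMSEQ_imp_Suc[of "\<lambda>n. cf_num a b n * t n"] by simp
  \<comment> \<open>The nonzero limit keeps both factors eventually nonzero: \<open>t n\<close> can
    be cancelled from the quotient, and the denominators meet the convergence definition.\<close>
  have ev: "\<forall>\<^sub>F n in sequentially. cf_den a b n * t n \<noteq> 0"
    using tendsto_imp_eventually_ne[OF D \<open>t 0 \<noteq> 0\<close>] .
  have "(\<lambda>n. (cf_num a b n * t n) / (cf_den a b n * t n)) \<longlonglongrightarrow> a 0 * t 1 / t 0"
    by (intro tendsto_divide N D) fact
  then have "(\<lambda>n. cf_num a b n / cf_den a b n) \<longlonglongrightarrow> a 0 * t 1 / t 0"
    by (rule Lim_transform_eventually) (use ev in eventually_elim, auto)
  with ev show ?thesis
    unfolding cf_converges_to_def by (auto elim: eventually_mono)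
qed

lemma euler_wallis_bounded:
  fixes y a b :: "nat \<Rightarrow> complex"
  assumes z: "z \<noteq> 0" and r: "0 \<le> r" "r < 1" and C: "0 \<le> C"
    and y: "\<And>n. y (Suc (Suc n)) = b (Suc n) * y (Suc n) + a (Suc n) * y n"
    and b: "\<And>n. norm (b (Suc n) / z) \<le> 1 + C * r ^ n"
    and a: "\<And>n. norm (a (Suc n) / z\<^sup>2) \<le> C * r ^ n"
  shows "\<exists>K. \<forall>n. norm (y n / z ^ n) \<le> K"
proof (rule bounded_of_geometric_perturbation[OF r C])
  fix n
  have "y (Suc (Suc n)) / z ^ Suc (Suc n)
      = b (Suc n) / z * (y (Suc n) / z ^ Suc n) + a (Suc n) / z\<^sup>2 * (y n / z ^ n)"
    using z by (simp add: y field_simps power2_eq_square)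
  then have "norm (y (Suc (Suc n)) / z ^ Suc (Suc n))
      \<le> norm (b (Suc n) / z) * norm (y (Suc n) / z ^ Suc n)
        + norm (a (Suc n) / z\<^sup>2) * norm (y n / z ^ n)"
    by (metis norm_mult norm_triangle_ineq)
  also have "\<dots> \<le> (1 + C * r ^ n) * norm (y (Suc n) / z ^ Suc n)
        + C * r ^ n * norm (y n / z ^ n)"
    by (intro add_mono mult_right_mono a b norm_ge_zero)
  finally show "norm (y (Suc (Suc n)) / z ^ Suc (Suc n))
      \<le> (1 + C * r ^ n) * norm (y (Suc n) / z ^ Suc n) + C * r ^ n * norm (y n / z ^ n)" .
qed simp

section \<open>The Al-Salam-Carlitz continued fraction\<close>

theorem mainTheorem12:
  fixes q A \<delta> z :: complex
  assumes "0 < norm q" and "norm q < 1"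
    and "A \<noteq> 0" and "\<delta> \<noteq> 0"
    and "\<forall>k::nat. A \<noteq> inverse (q ^ k)"
    and "z \<noteq> 0"
    and "admissible_lower q (q / (z * \<delta>))"
    and "admissible_lower q (1 / (z * \<delta>))"
    and "z * (1 - 1 / (\<delta> * z)) * phi11 q (q / (A * z * \<delta>)) (1 / (z * \<delta>)) (1 / z) \<noteq> 0"
  shows "cf_converges_to
           (\<lambda>n. if n = 0 then 1 else q ^ n * (1 - A * q ^ (n - 1)) / (A * \<delta>))
           (\<lambda>n. z - (1 + inverse \<delta>) * q ^ n)
           (1 / (z * (1 - 1 / (\<delta> * z))) *
            (phi11 q (q / (A * z * \<delta>)) (q / (z * \<delta>)) (q / z) /
             phi11 q (q / (A * z * \<delta>)) (1 / (z * \<delta>)) (1 / z)))"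
proof -
  define a where "a = q / (A * z * \<delta>)"
  define c where "c = 1 / (z * \<delta>)"
  define w where "w = 1 / z"
  define r where "r = norm q"
  define \<alpha> where "\<alpha> = (\<lambda>n. if n = 0 then 1 else q ^ n * (1 - A * q ^ (n - 1)) / (A * \<delta>))"
  define \<beta> where "\<beta> = (\<lambda>n. z - (1 + inverse \<delta>) * q ^ n)"
  have r: "0 \<le> r" "r < 1" using assms by (auto simp: r_def)
  have q0: "q \<noteq> 0" using assms(1) by auto
  have c: "1 - c * q ^ k \<noteq> 0" for k
    using assms(8) q0 unfolding admissible_lower_def c_def[symmetric]
    by (auto simp: field_simps dest!: spec[of _ k])
  have qq: "1 - q * q ^ k \<noteq> 0" for k
  proof
    assume "1 - q * q ^ k = 0"
    then have "norm (q ^ Suc k) = 1" by simp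
    then show False
      using assms(1,2) power_Suc_less_one[of "norm q" k] by (simp add: norm_power norm_mult)
  qed
  define T where "T n = (\<Sum>k. phi_term q a c w n k)" for n
  obtain M where M: "\<And>n k. norm (phi_term q a c w n k)
      \<le> M * (norm q ^ (k * (k - 1) div 2) * norm w ^ k)"
    using phi_term_bound[OF assms(2) c qq] by blast
  have theta: "summable (\<lambda>k. M * (norm q ^ (k * (k - 1) div 2) * norm w ^ k))"
    using assms by (intro summable_mult summable_theta) auto
  have sumT: "summable (phi_term q a c w n)" for n
    by (rule summable_comparison_test'[OF theta]) (use M in auto)
  define L where "L = (\<Sum>k. M * (norm q ^ (k * (k - 1) div 2) * norm w ^ k))"
  have TL: "norm (T n) \<le> L" for n
    unfolding T_def L_def by (rule norm_suminf_le[OF M theta])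

  \<comment> \<open>The termwise relations are summed with index 0 split off. The middle term sums
    to \<open>- w * q ^ n * T (Suc n)\<close>, which turns \<open>c\<close> into
    \<open>w + c\<close> in the first coefficient.\<close>
  have contig: "T n = (1 - (w + c) * q ^ n) * T (Suc n)
      + w * q ^ n * (a - q * c * q ^ n) * T (Suc (Suc n))" for n
  proof -
    let ?U = "phi_term q a c w"
    have S: "(\<Sum>k. ?U m (Suc k)) = T m - ?U m 0" for m
      unfolding T_def by (rule suminf_split_head[OF sumT])
    have sumS: "summable (\<lambda>k. ?U m (Suc k))" for m
      using sumT by (simp only: summable_Suc_iff)
    have "T n - ?U n 0 = (\<Sum>k. (1 - c * q ^ n) * ?U (Suc n) (Suc k)
           - w * q ^ n * ?U (Suc n) k
           + w * q ^ n * (a - q * c * q ^ n) * ?U (Suc (Suc n)) k)"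
      unfolding S[symmetric] phi_term_contiguous(2)[OF c qq, of a w n] ..
    also have "\<dots> = (1 - c * q ^ n) * (T (Suc n) - ?U (Suc n) 0) - w * q ^ n * T (Suc n)
           + w * q ^ n * (a - q * c * q ^ n) * T (Suc (Suc n))"
      unfolding S[symmetric] unfolding T_def
      by (simp only: suminf_add[symmetric] suminf_diff[symmetric] suminf_mult
          summable_add summable_diff summable_mult sumS sumT)
    finally show ?thesis
      unfolding phi_term_contiguous(1)[OF c qq, of a w n] by (simp add: algebra_simps)
  qed

  \<comment> \<open>The parameters are matched here: \<open>w + c = (1 + 1 / \<delta>) / z\<close>,
    and \<open>a = q * c / A\<close> gives
    \<open>a - q * c * q ^ n = q * c * (1 - A * q ^ n) / A\<close>.\<close>
  have \<beta>z: "\<beta> n / z = 1 - (w + c) * q ^ n" for n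
    using assms(4,6) by (simp add: \<beta>_def w_def c_def field_simps)
  have \<alpha>z: "\<alpha> (Suc n) / z\<^sup>2 = w * q ^ n * (a - q * c * q ^ n)" for n
    using assms(3,4,6) by (simp add: \<alpha>_def w_def c_def a_def field_simps power2_eq_square)
  define t where "t n = T n / z ^ n" for n
  have t_rec: "t n = \<beta> n * t (Suc n) + \<alpha> (Suc n) * t (Suc (Suc n))" for n
  proof -
    have "t n = (\<beta> n / z * T (Suc n) + \<alpha> (Suc n) / z\<^sup>2 * T (Suc (Suc n))) / z ^ n"
      unfolding t_def \<beta>z \<alpha>z using contig[of n] by simp
    also have "\<dots> = \<beta> n * t (Suc n) + \<alpha> (Suc n) * t (Suc (Suc n))"
      using assms(6) by (simp add: t_def field_simps power2_eq_square)
    finally show ?thesis .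
  qed

  \<comment> \<open>The first summand controls the deviation of \<open>\<beta> (Suc n) / z\<close>
    from 1, the second controls \<open>\<alpha> (Suc n) / z\<^sup>2\<close>.\<close>
  define C where "C = norm (w + c) + norm w * (norm a + norm (q * c))"
  have C: "0 \<le> C" by (simp add: C_def)
  have \<beta>_bound: "norm (\<beta> (Suc n) / z) \<le> 1 + C * r ^ n" for n
  proof -
    have "norm (\<beta> (Suc n) / z) \<le> 1 + norm (w + c) * r ^ Suc n"
      unfolding \<beta>z r_def
      by (rule order_trans[OF norm_triangle_ineq4]) (simp add: norm_mult norm_power)
    also have "norm (w + c) * r ^ Suc n \<le> C * r ^ n"
      unfolding C_def using r by (intro mult_mono) (auto simp: mult_left_le_one_le)
    finally show ?thesis by simp
  qed
  have \<alpha>_bound: "norm (\<alpha> (Suc n) / z\<^sup>2) \<le> C * r ^ n" for n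
  proof -
    have "norm (a - q * c * q ^ n) \<le> norm a + norm (q * c) * r ^ n"
      unfolding r_def
      by (rule order_trans[OF norm_triangle_ineq4]) (simp add: norm_mult norm_power)
    also have "\<dots> \<le> norm a + norm (q * c)"
      using r by (auto intro!: mult_right_le_one_le power_le_one)
    finally have "norm w * norm (a - q * c * q ^ n) \<le> C"
      unfolding C_def by (smt (verit) mult_left_mono norm_ge_zero)
    then have "norm w * norm (a - q * c * q ^ n) * r ^ n \<le> C * r ^ n"
      using r by (intro mult_right_mono) auto
    then show ?thesis
      unfolding \<alpha>z by (simp add: norm_mult norm_power r_def mult_ac)
  qed
  have remainder: "(\<lambda>n. \<alpha> (Suc n) * (y n * t (Suc (Suc n)))) \<longlonglongrightarrow> 0"
    if y: "\<And>n. y (Suc (Suc n)) = \<beta> (Suc n) * y (Suc n) + \<alpha> (Suc n) * y n" for y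
  proof -
    obtain K where K: "\<And>n. norm (y n / z ^ n) \<le> K"
      using euler_wallis_bounded[OF assms(6) r C y \<beta>_bound \<alpha>_bound] by blast
    have K0: "0 \<le> K" using K[of 0] norm_ge_zero order_trans by blast
    have bound: "norm (\<alpha> (Suc n) * (y n * t (Suc (Suc n)))) \<le> C * r ^ n * (K * L)" for n
    proof -
      \<comment> \<open>The powers of \<open>z\<close> balance: \<open>t (Suc (Suc n))\<close>
        carries \<open>z ^ (n + 2)\<close> in its denominator, shared between
        \<open>\<alpha> (Suc n)\<close> and \<open>y n\<close>. Only the first of the resulting
        factors is needed to decay; the others are bounded.\<close>
      have "\<alpha> (Suc n) * (y n * t (Suc (Suc n)))
          = \<alpha> (Suc n) / z\<^sup>2 * (y n / z ^ n * T (Suc (Suc n)))"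
        using assms(6) by (simp add: t_def field_simps power2_eq_square)
      then show ?thesis
        using K TL[of "Suc (Suc n)"] \<alpha>_bound C r K0
        by (simp only: norm_mult) (intro mult_mono; simp)
    qed
    have "(\<lambda>n. C * r ^ n * (K * L)) \<longlonglongrightarrow> 0"
    proof -
      have "(\<lambda>n. r ^ n) \<longlonglongrightarrow> 0" using r by (intro LIMSEQ_power_zero) simp
      from tendsto_mult[OF tendsto_mult[OF tendsto_const this] tendsto_const, of C "K * L"]
      show ?thesis by simp
    qed
    then show ?thesis
      by (rule Lim_null_comparison[OF always_eventually[OF allI[OF bound]]])
  qed

  have T0: "T 0 = phi11 q a c w"
    unfolding T_def phi11_def phi_term_def by simp
  \<comment> \<open>Splitting the first factor off \<open>qpoch q c (Suc k)\<close> changes the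
    lower parameter to \<open>c * q\<close>; the factor \<open>1 - c\<close> is the source of
    \<open>1 - 1 / (\<delta> * z)\<close> in the claimed value.\<close>
  have T1: "phi11 q a (q / (z * \<delta>)) (q / z) = (1 - c) * T 1"
  proof -
    have "qpoch q a k / (qpoch q (c * q) k * qpoch q q k) * (-1) ^ k
        * q ^ (k * (k - 1) div 2) * (q * w) ^ k = (1 - c) * phi_term q a c w 1 k" for k
      using c[of 0] by (simp add: phi_term_def qpoch_shift mult_ac)
    then have "phi11 q a (c * q) (q * w) = (1 - c) * T 1"
      unfolding phi11_def T_def suminf_mult[OF sumT, symmetric] by simp
    then show ?thesis by (simp add: c_def w_def)
  qed
  have "t 0 \<noteq> 0"
    using assms(9) unfolding a_def[symmetric] c_def[symmetric] w_def[symmetric] T0[symmetric]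
    by (simp add: t_def)
  then have "cf_converges_to \<alpha> \<beta> (\<alpha> 0 * t 1 / t 0)"
    by (intro cf_converges_to_adjoint t_rec remainder) simp_all
  \<comment> \<open>The factor \<open>1 / z\<close> comes from \<open>t 1 = T 1 / z\<close>.\<close>
  also have "\<alpha> 0 * t 1 / t 0 = 1 / (z * (1 - 1 / (\<delta> * z))) *
      (phi11 q a (q / (z * \<delta>)) (q / z) / phi11 q a c w)"
  proof -
    have "1 - 1 / (\<delta> * z) = 1 - c" by (simp add: c_def mult.commute)
    then show ?thesis
      unfolding T1 T0[symmetric] using c[of 0] by (simp add: t_def \<alpha>_def)
  qed
  finally show ?thesis
    unfolding \<alpha>_def \<beta>_def a_def c_def w_def .
qed

end
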